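(* Let $\mathcal{H}$ be a non-trivial complex Hilbert space, let $A\in\mathcal{B}(\mathcal{H})$ be a positive operator, let $T_{11}, T_{12}, T_{21},T_{22} \in \mathcal{B}_A(\mathcal{H})$, and let $T=\begin{pmatrix} T_{11}&T_{12} \\ T_{21}& T_{22}\end{pmatrix}$ and $B=\begin{pmatrix} A&O\\ O&A\end{pmatrix}$, acting on $\mathcal{H}\oplus\mathcal{H}$. Then $$w_B(T) \leq \frac{1}{2}\left [w_A(T_{11})+w_A(T_{22})+\sqrt{w^2_A(T_{11})+\|T_{12}\|_A^2}+\sqrt{w^2_A(T_{22})+\|T_{21}\|_A^2} \right].$$
   Context: $\mathcal{B}(\mathcal{H})$ is the algebra of bounded linear operators on the complex Hilbert space $(\mathcal{H},\langle\cdot,\cdot\rangle)$; $O$ is the zero operator. $A\in\mathcal{B}(\mathcal{H})$ is positive if $\langle Ax,x\rangle\ge 0$ for all $x\in\mathcal{H}$. Put $\langle x,y\rangle_A=\langle Ax,y\rangle$ and $\|x\|_A=\sqrt{\langle x,x\rangle_A}$ (a semi-norm). $\mathcal{B}_A(\mathcal{H})$ is the set of $T\in\mathcal{B}(\mathcal{H})$ that admit an $A$-adjoint, i.e. some $R\in\mathcal{B}(\mathcal{H})$ with $AR=T^*A$; equivalently $\mathcal{R}(T^*A)\subseteq\mathcal{R}(A)$, where $\mathcal{R}$ denotes range. For such operators, $\|T\|_A=\sup\{\|Tx\|_A/\|x\|_A : x\in\overline{\mathcal{R}(A)},\,x\ne 0\}$ (finite), $w_A(T)=\sup\{|\langle Tx,x\rangle_A|: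 x\in\mathcal{H},\|x\|_A=1\}$ ($A$-numerical radius), and $w_A^2(T)=(w_A(T))^2$. The $B$-numerical radius $w_B$ is defined in the same way with $(\mathcal{H},A)$ replaced by $(\mathcal{H}\oplus\mathcal{H},B)$; $B$ is positive on $\mathcal{H}\oplus\mathcal{H}$. *)

theory Defs
  imports "HOL-Analysis.Analysis"
begin

(* Built on top of real_inner, so that norm, topology and direct sums are those of the library.
   Positive definiteness of cinner and the identity norm x = sqrt (cinner x x) follow from
   inner_eq_Re_cinner. Convention: cinner is linear in its first argument. *)
class complex_inner = real_inner +
  fixes scaleC :: "complex \<Rightarrow> 'a \<Rightarrow> 'a"  (infixr "*\<^sub>C" 75)
    and cinner :: "'a \<Rightarrow> 'a \<Rightarrow> complex"
  assumes scaleC_add_right: "c *\<^sub>C (x + y) = c *\<^sub>C x + c *\<^sub>C y"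
    and scaleC_add_left: "(c + d) *\<^sub>C x = c *\<^sub>C x + d *\<^sub>C x"
    and scaleC_scaleC: "c *\<^sub>C (d *\<^sub>C x) = (c * d) *\<^sub>C x"
    and scaleR_scaleC: "r *\<^sub>R x = complex_of_real r *\<^sub>C x"
    and cinner_commute: "cinner x y = cnj (cinner y x)"
    and cinner_add_left: "cinner (x + y) z = cinner x z + cinner y z"
    and cinner_scaleC_left: "cinner (c *\<^sub>C x) y = c * cinner x y"
    and inner_eq_Re_cinner: "inner x y = Re (cinner x y)"

class complex_hilbert = complex_inner + complete_space

instantiation prod :: (complex_inner, complex_inner) complex_inner
begin

definition scaleC_prod :: "complex \<Rightarrow> 'a \<times> 'b \<Rightarrow> 'a \<times> 'b" where
  "scaleC_prod c p = (c *\<^sub>C fst p, c *\<^sub>C snd p)"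

definition cinner_prod :: "'a \<times> 'b \<Rightarrow> 'a \<times> 'b \<Rightarrow> complex" where
  "cinner_prod p q = cinner (fst p) (fst q) + cinner (snd p) (snd q)"

instance
proof
  fix p q :: "'a \<times> 'b"
  show "cinner p q = cnj (cinner q p)"
    unfolding cinner_prod_def
    using cinner_commute[of "fst p" "fst q"] cinner_commute[of "snd p" "snd q"] by simp
qed (simp_all add: scaleC_prod_def cinner_prod_def prod_eq_iff scaleC_add_right scaleC_add_left
    scaleC_scaleC scaleR_scaleC cinner_add_left cinner_scaleC_left inner_eq_Re_cinner
    inner_prod_def algebra_simps)

end

instance prod :: (complex_hilbert, complex_hilbert) complex_hilbert ..

definition bounded_ops :: "('a::complex_inner \<Rightarrow> 'a) set" where
  "bounded_ops = {T. bounded_linear T \<and> (\<forall>c x. T (c *\<^sub>C x) = c *\<^sub>C T x)}"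

definition cadjoint :: "('a::complex_inner \<Rightarrow> 'a) \<Rightarrow> 'a \<Rightarrow> 'a" where
  "cadjoint T = (THE S. \<forall>x y. cinner (T x) y = cinner x (S y))"

(* Membership in the nonnegative reals, as a subset of the complex numbers, includes that
   the value is real. *)
definition positive_op :: "('a::complex_inner \<Rightarrow> 'a) \<Rightarrow> bool" where
  "positive_op A \<longleftrightarrow> A \<in> bounded_ops \<and> (\<forall>x. cinner (A x) x \<in> \<real>\<^sub>\<ge>\<^sub>0)"

definition A_inner :: "('a::complex_inner \<Rightarrow> 'a) \<Rightarrow> 'a \<Rightarrow> 'a \<Rightarrow> complex" where
  "A_inner A x y = cinner (A x) y"

definition A_seminorm :: "('a::complex_inner \<Rightarrow> 'a) \<Rightarrow> 'a \<Rightarrow> real" where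
  "A_seminorm A x = sqrt (Re (A_inner A x x))"

definition A_adjointable :: "('a::complex_inner \<Rightarrow> 'a) \<Rightarrow> ('a \<Rightarrow> 'a) set" where
  "A_adjointable A = {T \<in> bounded_ops. \<exists>R \<in> bounded_ops. A \<circ> R = cadjoint T \<circ> A}"

(* In the two suprema all values are nonnegative; adjoining 0 only fixes the convention that
   the supremum of the empty set, which arises exactly when A = 0, is 0. *)
definition A_opnorm :: "('a::complex_inner \<Rightarrow> 'a) \<Rightarrow> ('a \<Rightarrow> 'a) \<Rightarrow> real" where
  "A_opnorm A T =
    Sup (insert 0 {A_seminorm A (T x) / A_seminorm A x | x. x \<in> closure (range A) \<and> x \<noteq> 0})"

definition A_numerical_radius :: "('a::complex_inner \<Rightarrow> 'a) \<Rightarrow> ('a \<Rightarrow> 'a) \<Rightarrow> real" where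
  "A_numerical_radius A T = Sup (insert 0 {cmod (A_inner A (T x) x) | x. A_seminorm A x = 1})"

definition block_op ::
  "('a::complex_inner \<Rightarrow> 'a) \<Rightarrow> ('a \<Rightarrow> 'a) \<Rightarrow> ('a \<Rightarrow> 'a) \<Rightarrow> ('a \<Rightarrow> 'a) \<Rightarrow> 'a \<times> 'a \<Rightarrow> 'a \<times> 'a" where
  "block_op T11 T12 T21 T22 = (\<lambda>(x, y). (T11 x + T12 y, T21 x + T22 y))"

end

theory Submission
  imports Defs
begin

text \<open>For \<open>p = (x, y)\<close> with \<open>a\<^sup>2 + b\<^sup>2 = 1\<close>, where \<open>a\<close> and \<open>b\<close> are the \<open>A\<close>-semi-norms of \<open>x\<close> and \<open>y\<close>,
  pair the entries of the form of \<open>T\<close> at \<open>p\<close> row by row: the first row is at most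
  \<open>w\<^sub>A(T11) a\<^sup>2 + N a b\<close>, with \<open>N\<close> the \<open>A\<close>-norm of \<open>T12\<close>, which is bounded by the largest
  eigenvalue of a symmetric \<open>2 \<times> 2\<close> matrix; similarly for the second row. These estimates need
  the two suprema to be finite, that is, \<open>A\<close>-boundedness of \<open>A\<close>-adjointable operators. If \<open>R\<close> is
  an \<open>A\<close>-adjoint of \<open>T\<close>, then \<open>S = R T\<close> is \<open>A\<close>-symmetric, so by Cauchy--Schwarz the sequence
  of \<open>A\<close>-semi-norms of \<open>S\<^sup>k x\<close> is log-convex; it grows at most like the powers of the operator
  norm of \<open>S\<close>, which therefore already bounds its first ratio.\<close>

section \<open>Real inequalities\<close>

text \<open>For \<open>r > 0\<close> the minimiser \<open>t = - q / r\<close> gives the bound. For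
  \<open>r = 0\<close> an affine function that is bounded below has slope 0; this case covers
  vectors of semi-norm 0.\<close>

lemma quadratic_nonneg_discriminant:
  fixes p q r :: real
  assumes r: "0 \<le> r" and nn: "\<And>t. 0 \<le> p + 2 * t * q + t\<^sup>2 * r"
  shows "q\<^sup>2 \<le> p * r"
proof (cases "r = 0")
  case True
  have "q = 0"
  proof (rule ccontr)
    assume "q \<noteq> 0"
    then show False using nn[of "- (p + 1) / (2 * q)"] True by (simp add: field_simps)
  qed
  then show ?thesis using True by simp
next
  case False
  with r have "0 < r" by simp
  then have "p + 2 * (- q / r) * q + (- q / r)\<^sup>2 * r = (p * r - q\<^sup>2) / r"
    by (simp add: field_simps power2_eq_square)
  with nn[of "- q / r"] \<open>0 < r\<close> show ?thesis by (simp add: zero_le_divide_iff)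
qed

text \<open>The factor on the right is the largest eigenvalue of the symmetric matrix with rows
  \<open>(w, N/2)\<close> and \<open>(N/2, 0)\<close>.\<close>

lemma quadratic_form_le_eigenvalue:
  fixes w N a b :: real
  assumes "0 \<le> w"
  shows "w * a\<^sup>2 + N * a * b \<le> (w + sqrt (w\<^sup>2 + N\<^sup>2)) / 2 * (a\<^sup>2 + b\<^sup>2)"
proof -
  define s where "s = sqrt (w\<^sup>2 + N\<^sup>2)"
  have s2: "s\<^sup>2 = w\<^sup>2 + N\<^sup>2" and "w \<le> s"
    using assms by (simp_all add: s_def real_le_rsqrt)
  have "N * a * b \<le> (s - w) / 2 * a\<^sup>2 + (s + w) / 2 * b\<^sup>2"
  proof -
    \<comment> \<open>The coefficients of \<open>a\<close> and \<open>b\<close> are chosen so that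
      their product is \<open>(N/2)^2\<close>; the cross term of the square is then \<open>N\<close>
      times \<open>a * b\<close> in absolute value.\<close>
    have "0 \<le> (sqrt ((s - w) / 2) * \<bar>a\<bar> - sqrt ((s + w) / 2) * \<bar>b\<bar>)\<^sup>2" by simp
    also have "\<dots> = (s - w) / 2 * a\<^sup>2 + (s + w) / 2 * b\<^sup>2
        - 2 * sqrt ((s - w) / 2 * ((s + w) / 2)) * \<bar>a\<bar> * \<bar>b\<bar>"
      using assms \<open>w \<le> s\<close> by (simp add: power2_diff power_mult_distrib real_sqrt_mult[symmetric])
    also have "(s - w) / 2 * ((s + w) / 2) = (N / 2)\<^sup>2"
      using s2 by (simp add: field_simps power2_eq_square)
    finally have "\<bar>N\<bar> * \<bar>a\<bar> * \<bar>b\<bar> \<le> (s - w) / 2 * a\<^sup>2 + (s + w) / 2 * b\<^sup>2" by simp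
    moreover have "N * a * b \<le> \<bar>N\<bar> * \<bar>a\<bar> * \<bar>b\<bar>" by (metis abs_ge_self abs_mult)
    ultimately show ?thesis by linarith
  qed
  then show ?thesis unfolding s_def[symmetric] by (simp add: field_simps)
qed

text \<open>Log-convexity makes the ratios of successive terms non-decreasing. A first ratio
  \<open>q > K\<close> would thus force \<open>g k >= q ^ k * g 0\<close>, which eventually exceeds
  \<open>C * K ^ k\<close>.\<close>

lemma log_convex_geometric_bound:
  fixes g :: "nat \<Rightarrow> real"
  assumes nonneg: "\<And>k. 0 \<le> g k"
    and convex: "\<And>k. (g (Suc k))\<^sup>2 \<le> g k * g (Suc (Suc k))"
    and K: "0 \<le> K" and growth: "\<And>k. g k \<le> C * K ^ k"
  shows "g 1 \<le> K * g 0"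
proof (rule ccontr)
  assume "\<not> g 1 \<le> K * g 0"
  then have less: "K * g 0 < g 1" by simp
  have "0 \<le> K * g 0" using K nonneg[of 0] by simp
  then have "0 < g 1" using less by linarith
  have "0 < g 0" using convex[of 0] nonneg[of 0] \<open>0 < g 1\<close>
    by (cases "g 0 = 0") auto
  have "K \<noteq> 0" using growth[of 1] \<open>0 < g 1\<close> by auto
  with K have "0 < K" by simp
  define q where "q = g 1 / g 0"
  have "K < q" using less \<open>0 < g 0\<close> by (simp add: q_def field_simps)
  have "0 < q" using \<open>0 < K\<close> \<open>K < q\<close> by linarith
  have step: "0 < g k \<and> q * g k \<le> g (Suc k)" for k
  proof (induction k)
    case 0
    show ?case using \<open>0 < g 0\<close> by (simp add: q_def)
  next
    case (Suc k)
    then have pos: "0 < g (Suc k)"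
      using \<open>0 < q\<close> by (meson less_le_trans mult_pos_pos)
    have "g k * (q * g (Suc k)) = (q * g k) * g (Suc k)" by simp
    also have "\<dots> \<le> g (Suc k) * g (Suc k)" using Suc pos by (intro mult_right_mono) auto
    also have "\<dots> \<le> g k * g (Suc (Suc k))" using convex[of k] by (simp add: power2_eq_square)
    finally show ?case using Suc pos by simp
  qed
  have lower: "q ^ k * g 0 \<le> g k" for k
  proof (induction k)
    case (Suc k)
    have "q ^ Suc k * g 0 = q * (q ^ k * g 0)" by simp
    also have "\<dots> \<le> q * g k" using Suc \<open>0 < q\<close> by (intro mult_left_mono) auto
    also have "\<dots> \<le> g (Suc k)" using step by blast
    finally show ?case .
  qed simp
  obtain k where "C / g 0 < (q / K) ^ k"
    using real_arch_pow[of "q / K" "C / g 0"] \<open>K < q\<close> \<open>0 < K\<close> by auto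
  moreover have "q ^ k * g 0 \<le> C * K ^ k" using lower growth order_trans by blast
  ultimately show False using \<open>0 < K\<close> \<open>0 < g 0\<close>
    by (simp add: field_simps power_divide)
qed

section \<open>Orthogonal projection and adjoints\<close>

lemma subspace_closure:
  fixes M :: "'a::real_normed_vector set"
  assumes "subspace M"
  shows "subspace (closure M)"
  unfolding subspace_def
proof (intro conjI ballI allI)
  show "0 \<in> closure M" using subspace_0[OF assms] closure_subset by blast
next
  fix x y assume "x \<in> closure M" "y \<in> closure M"
  then obtain f g where "\<forall>n. f n \<in> M" "f \<longlonglongrightarrow> x" "\<forall>n. g n \<in> M" "g \<longlonglongrightarrow> y"
    by (auto simp: closure_sequential)
  then show "x + y \<in> closure M"
    unfolding closure_sequential using subspace_add[OF assms]
    by (intro exI[of _ "\<lambda>n. f n + g n"]) (auto intro: tendsto_add)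
next
  fix c :: real and x assume "x \<in> closure M"
  then obtain f where "\<forall>n. f n \<in> M" "f \<longlonglongrightarrow> x" by (auto simp: closure_sequential)
  then show "c *\<^sub>R x \<in> closure M"
    unfolding closure_sequential using subspace_scale[OF assms]
    by (intro exI[of _ "\<lambda>n. c *\<^sub>R f n"]) (auto intro: tendsto_intros)
qed

text \<open>The point \<open>a\<close> minimises the distance to \<open>x\<close>. The sets
  \<open>S n\<close> of near-minimisers are closed, nested and of diameter tending to 0, so
  completeness gives them a common point.\<close>

lemma orthogonal_projection_exists:
  fixes M :: "'a::{real_inner,complete_space} set"
  assumes "closed M" and "subspace M"
  obtains a where "a \<in> M" and "\<And>m. m \<in> M \<Longrightarrow> inner (x - a) m = 0"
proof -
  define D where "D = (INF m\<in>M. (norm (m - x))\<^sup>2)"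
  have "M \<noteq> {}" using \<open>subspace M\<close> subspace_0 by auto
  have bdd: "bdd_below ((\<lambda>m. (norm (m - x))\<^sup>2) ` M)" by (rule bdd_belowI[of _ 0]) auto
  have D_le: "D \<le> (norm (m - x))\<^sup>2" if "m \<in> M" for m
    unfolding D_def using bdd that by (rule cINF_lower)
  define S where "S n = {m \<in> M. (norm (m - x))\<^sup>2 \<le> D + 1 / real (Suc n)}" for n
  have "\<exists>a. \<forall>n. a \<in> S n"
  proof (rule decreasing_closed_nest[of S])
    fix n
    have "closed (M \<inter> {m. (norm (m - x))\<^sup>2 \<le> D + 1 / real (Suc n)})"
      by (intro closed_Int closed_Collect_le \<open>closed M\<close> continuous_intros)
    then show "closed (S n)" by (simp add: S_def Int_def)
    have "\<exists>m\<in>M. (norm (m - x))\<^sup>2 < D + 1 / real (Suc n)"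
      unfolding D_def using cINF_less_iff[OF \<open>M \<noteq> {}\<close> bdd] by (metis D_def less_add_same_cancel1
          of_nat_0_less_iff zero_less_Suc zero_less_divide_1_iff)
    then show "S n \<noteq> {}" by (force simp: S_def)
  next
    fix m n :: nat assume "m \<le> n"
    then have "1 / real (Suc n) \<le> 1 / real (Suc m)" by (simp add: frac_le)
    then show "S n \<subseteq> S m" by (force simp: S_def)
  next
    fix \<epsilon> :: real assume "0 < \<epsilon>"
    then obtain n where n: "1 / real (Suc n) < \<epsilon>\<^sup>2 / 4"
      using nat_approx_posE[of "\<epsilon>\<^sup>2 / 4"] by auto
    have "dist y z < \<epsilon>" if "y \<in> S n" "z \<in> S n" for y z
    proof -
      have "(1/2) *\<^sub>R (y + z) \<in> M"
        using that \<open>subspace M\<close> by (auto simp: S_def subspace_add subspace_scale)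
      then have "D \<le> (norm ((1/2) *\<^sub>R (y + z) - x))\<^sup>2" by (rule D_le)
      \<comment> \<open>The parallelogram law for \<open>y - x\<close> and \<open>z - x\<close>. As
        the midpoint lies in \<open>M\<close>, the right side is at most
        \<open>4 * (D + 1 / Suc n) - 4 * D\<close>, whence the 4 in the choice of
        \<open>n\<close>.\<close>
      moreover have "(norm (y - z))\<^sup>2 = 2 * (norm (y - x))\<^sup>2 + 2 * (norm (z - x))\<^sup>2
          - 4 * (norm ((1/2) *\<^sub>R (y + z) - x))\<^sup>2"
        unfolding power2_norm_eq_inner by (simp add: algebra_simps inner_commute)
      ultimately have "(norm (y - z))\<^sup>2 \<le> 4 * (1 / real (Suc n))"
        using that by (simp add: S_def)
      then have "(norm (y - z))\<^sup>2 < \<epsilon>\<^sup>2" using n by linarith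
      then show ?thesis using \<open>0 < \<epsilon>\<close> by (simp add: dist_norm power2_less_imp_less)
    qed
    then show "\<exists>n. \<forall>y\<in>S n. \<forall>z\<in>S n. dist y z < \<epsilon>" by blast
  qed blast
  then obtain a where a: "\<And>n. a \<in> S n" by blast
  have "a \<in> M" using a[of 0] by (simp add: S_def)
  have "(norm (a - x))\<^sup>2 \<le> D"
  proof (rule field_le_epsilon)
    fix e :: real assume "0 < e"
    then obtain n where "1 / real (Suc n) < e" using nat_approx_posE[of e] by auto
    then show "(norm (a - x))\<^sup>2 \<le> D + e" using a[of n] by (simp add: S_def)
  qed
  then have min: "(norm (a - x))\<^sup>2 \<le> (norm (m - x))\<^sup>2" if "m \<in> M" for m
    using D_le[OF that] by linarith
  have "inner (x - a) m = 0" if "m \<in> M" for m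
  proof -
    \<comment> \<open>Minimality of \<open>a\<close> against the competitor \<open>a - t m\<close>;
      with constant term 0 the discriminant bound makes the linear coefficient vanish.\<close>
    have "0 \<le> 0 + 2 * t * inner (x - a) m + t\<^sup>2 * (norm m)\<^sup>2" for t
    proof -
      have "a - t *\<^sub>R m \<in> M"
        using \<open>a \<in> M\<close> that \<open>subspace M\<close> by (auto simp: subspace_diff subspace_scale)
      from min[OF this] show ?thesis
        unfolding power2_norm_eq_inner by (simp add: algebra_simps inner_commute power2_eq_square)
    qed
    from quadratic_nonneg_discriminant[OF _ this] show ?thesis by simp
  qed
  with \<open>a \<in> M\<close> show thesis by (rule that)
qed

text \<open>A vector \<open>n\<close> orthogonal to the kernel determines the functional, since each
  \<open>x\<close> differs from a multiple of \<open>n\<close> by an element of the kernel.\<close>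

lemma riesz_representation:
  fixes \<phi> :: "'a::{real_inner,complete_space} \<Rightarrow> real"
  assumes "bounded_linear \<phi>"
  obtains z where "\<And>x. \<phi> x = inner x z"
proof (cases "\<forall>x. \<phi> x = 0")
  case True
  then show thesis using that[of 0] by simp
next
  case False
  then obtain u where u: "\<phi> u \<noteq> 0" by blast
  interpret bounded_linear \<phi> by fact
  have "closed {x. \<phi> x = 0}"
    by (intro closed_Collect_eq continuous_intros linear_continuous_on assms)
  moreover have "subspace {x. \<phi> x = 0}" by (auto simp: subspace_def add scaleR)
  ultimately obtain a where a: "\<phi> a = 0" and orth: "\<And>m. \<phi> m = 0 \<Longrightarrow> inner (u - a) m = 0"
    by (rule orthogonal_projection_exists[of "{x. \<phi> x = 0}" u]) auto
  define n where "n = u - a"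
  have "\<phi> n = \<phi> u" by (simp add: n_def diff a)
  with u have n: "\<phi> n \<noteq> 0" by simp
  then have "n \<noteq> 0" using zero by auto
  show thesis
  proof (rule that)
    fix x
    have "\<phi> (x - (\<phi> x / \<phi> n) *\<^sub>R n) = 0" using n by (simp add: diff scaleR)
    then have "inner n (x - (\<phi> x / \<phi> n) *\<^sub>R n) = 0" using orth n_def by blast
    then have "inner x n = \<phi> x / \<phi> n * inner n n"
      by (simp add: inner_diff_right inner_commute)
    then show "\<phi> x = inner x ((\<phi> n / inner n n) *\<^sub>R n)"
      using n \<open>n \<noteq> 0\<close> by simp
  qed
qed

lemma cinner_add_right: "cinner x (y + z) = cinner x y + cinner x z"
  by (metis cinner_add_left cinner_commute complex_cnj_add)

lemma cinner_scaleC_right: "cinner x (c *\<^sub>C y) = cnj c * cinner x y"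
  by (metis cinner_commute cinner_scaleC_left complex_cnj_mult)

text \<open>Lets complex identities be derived from real ones for maps that commute with
  multiplication by \<open>\<i>\<close>.\<close>

lemma Im_cinner: "Im (cinner x y) = - inner (\<i> *\<^sub>C x) y"
  by (simp add: inner_eq_Re_cinner cinner_scaleC_left)

lemma bounded_ops_linear: "T \<in> bounded_ops \<Longrightarrow> bounded_linear T"
  by (simp add: bounded_ops_def)

lemma bounded_ops_scaleC: "T \<in> bounded_ops \<Longrightarrow> T (c *\<^sub>C x) = c *\<^sub>C T x"
  by (simp add: bounded_ops_def)

text \<open>\<open>cadjoint\<close> is a definite description, so existence and uniqueness must both
  be shown. Real Riesz representation gives the candidate, and complex linearity of \<open>T\<close>
  transfers the identity to imaginary parts.\<close>

lemma cinner_cadjoint: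
  fixes T :: "'a::complex_hilbert \<Rightarrow> 'a"
  assumes "T \<in> bounded_ops"
  shows "cinner (T x) y = cinner x (cadjoint T y)"
proof -
  have "\<exists>z. \<forall>x. inner (T x) y = inner x z" for y
  proof -
    have "bounded_linear (\<lambda>x. inner (T x) y)"
      using bounded_linear_compose[OF bounded_linear_inner_left bounded_ops_linear[OF assms]] .
    then show ?thesis by (rule riesz_representation) blast
  qed
  then obtain S where S: "inner (T x) y = inner x (S y)" for x y by metis
  have S_adj: "\<forall>x y. cinner (T x) y = cinner x (S y)"
  proof (intro allI complex_eqI)
    fix x y
    show "Re (cinner (T x) y) = Re (cinner x (S y))"
      using S by (simp add: inner_eq_Re_cinner)
    show "Im (cinner (T x) y) = Im (cinner x (S y))"
      using S by (simp add: Im_cinner bounded_ops_scaleC[OF assms, symmetric])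
  qed
  have "S' = S" if "\<forall>x y. cinner (T x) y = cinner x (S' y)" for S'
  proof
    fix y
    have "inner x (S' y) = inner x (S y)" for x
      using that S_adj by (metis inner_eq_Re_cinner)
    then show "S' y = S y" by (metis inner_diff_right inner_eq_zero_iff right_minus_eq)
  qed
  with S_adj have "\<exists>!S. \<forall>x y. cinner (T x) y = cinner x (S y)" by blast
  from theI'[OF this] show ?thesis unfolding cadjoint_def by blast
qed

section \<open>The semi-norm of a positive operator\<close>

locale positive_operator =
  fixes A :: "'a::complex_hilbert \<Rightarrow> 'a"
  assumes pos: "positive_op A"
begin

lemma in_bounded_ops: "A \<in> bounded_ops"
  using pos by (simp add: positive_op_def)

lemmas linear_A = bounded_ops_linear[OF in_bounded_ops]

sublocale bounded_linear A
  by (rule linear_A)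

lemma Re_nonneg: "0 \<le> Re (cinner (A x) x)" and Im_zero: "Im (cinner (A x) x) = 0"
  using pos by (simp_all add: positive_op_def complex_nonneg_Reals_iff)

lemma inner_nonneg: "0 \<le> inner (A x) x"
  by (simp add: inner_eq_Re_cinner Re_nonneg)

lemma symmetric: "inner (A x) y = inner x (A y)"
proof -
  \<comment> \<open>Polarisation: the cross terms are \<open>- \<i> <Ax, y> + \<i> <Ay, x>\<close>,
    with imaginary part \<open>Re <Ay, x> - Re <Ax, y>\<close>.\<close>
  have "Im (cinner (A (x + \<i> *\<^sub>C y)) (x + \<i> *\<^sub>C y)) = 0" by (rule Im_zero)
  then have "Re (cinner (A x) y) = Re (cinner (A y) x)"
    using Im_zero[of x] Im_zero[of y]
    by (simp add: add bounded_ops_scaleC[OF in_bounded_ops] cinner_add_left cinner_add_right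
        cinner_scaleC_left cinner_scaleC_right)
  then show ?thesis by (metis inner_commute inner_eq_Re_cinner)
qed

lemma A_seminorm_square: "(A_seminorm A x)\<^sup>2 = inner (A x) x"
  by (simp add: A_seminorm_def A_inner_def Re_nonneg inner_eq_Re_cinner)

lemma A_seminorm_nonneg: "0 \<le> A_seminorm A x"
  by (simp add: A_seminorm_def A_inner_def Re_nonneg)

lemma inner_Cauchy_Schwarz: "inner (A x) y \<le> A_seminorm A x * A_seminorm A y"
proof -
  have "0 \<le> inner (A x) x + 2 * t * inner (A x) y + t\<^sup>2 * inner (A y) y" for t
  proof -
    have "inner (A (x + t *\<^sub>R y)) (x + t *\<^sub>R y)
        = inner (A x) x + 2 * t * inner (A x) y + t\<^sup>2 * inner (A y) y"
      using symmetric[of y x]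
      by (simp add: add scaleR inner_add_left inner_add_right power2_eq_square algebra_simps
          inner_commute)
    then show ?thesis using inner_nonneg by metis
  qed
  from quadratic_nonneg_discriminant[OF inner_nonneg this]
  have "(inner (A x) y)\<^sup>2 \<le> (A_seminorm A x * A_seminorm A y)\<^sup>2"
    by (simp add: power_mult_distrib A_seminorm_square)
  then show ?thesis
    by (rule power2_le_imp_le) (simp add: A_seminorm_nonneg)
qed

lemma A_seminorm_scaleC: "A_seminorm A (c *\<^sub>C x) = cmod c * A_seminorm A x"
proof -
  have "A_inner A (c *\<^sub>C x) (c *\<^sub>C x) = complex_of_real ((cmod c)\<^sup>2) * A_inner A x x"
    unfolding complex_norm_square A_inner_def bounded_ops_scaleC[OF in_bounded_ops]
      cinner_scaleC_left cinner_scaleC_right by (simp only: mult_ac)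
  then have "Re (A_inner A (c *\<^sub>C x) (c *\<^sub>C x)) = (cmod c)\<^sup>2 * Re (A_inner A x x)"
    by (simp del: of_real_power)
  then show ?thesis by (simp add: A_seminorm_def real_sqrt_mult)
qed

lemma A_seminorm_scaleR: "A_seminorm A (r *\<^sub>R x) = \<bar>r\<bar> * A_seminorm A x"
  by (simp add: scaleR_scaleC A_seminorm_scaleC)

lemma A_inner_Cauchy_Schwarz: "cmod (A_inner A x y) \<le> A_seminorm A x * A_seminorm A y"
proof -
  \<comment> \<open>Multiplication by \<open>c\<close> rotates the form onto the nonnegative real
    axis, which reduces the claim to the real inequality. If the form vanishes then
    \<open>c = 0\<close>, so only \<open>cmod c <= 1\<close> holds in general.\<close>
  define c where "c = cnj (sgn (A_inner A x y))"
  have "c * A_inner A x y = complex_of_real (cmod (A_inner A x y))"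
  proof -
    have "cnj z * z = complex_of_real (cmod z * cmod z)" for z
      by (metis complex_norm_square mult.commute power2_eq_square)
    then show ?thesis by (simp add: c_def sgn_eq)
  qed
  then have "cmod (A_inner A x y) = Re (c * A_inner A x y)" by simp
  also have "\<dots> = inner (A (c *\<^sub>C x)) y"
    by (simp add: inner_eq_Re_cinner A_inner_def bounded_ops_scaleC[OF in_bounded_ops] cinner_scaleC_left)
  also have "\<dots> \<le> cmod c * A_seminorm A x * A_seminorm A y"
    using inner_Cauchy_Schwarz[of "c *\<^sub>C x" y] by (simp add: A_seminorm_scaleC)
  also have "\<dots> \<le> 1 * A_seminorm A x * A_seminorm A y"
    by (intro mult_right_mono) (auto simp: c_def norm_sgn A_seminorm_nonneg)
  finally show ?thesis by simp
qed

lemma A_seminorm_le_norm: "A_seminorm A x \<le> sqrt (onorm A) * norm x"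
proof (rule power2_le_imp_le)
  have "inner (A x) x \<le> norm (A x) * norm x" by (rule norm_cauchy_schwarz)
  also have "\<dots> \<le> onorm A * norm x * norm x"
    by (intro mult_right_mono onorm linear_A) auto
  also have "\<dots> = (sqrt (onorm A) * norm x)\<^sup>2"
    by (simp add: power_mult_distrib onorm_pos_le[OF linear_A] power2_eq_square[of "norm x"])
  finally show "(A_seminorm A x)\<^sup>2 \<le> (sqrt (onorm A) * norm x)\<^sup>2"
    by (simp add: A_seminorm_square)
qed (simp add: onorm_pos_le[OF linear_A])

text \<open>By Cauchy--Schwarz, applied to \<open>y\<close> and \<open>- y\<close>, a null vector is
  orthogonal to every vector for the form of \<open>A\<close>.\<close>

lemma A_seminorm_add_null:
  assumes "A_seminorm A y = 0"
  shows "A_seminorm A (x + y) = A_seminorm A x"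
proof -
  have "inner (A x) y = 0"
    using inner_Cauchy_Schwarz[of x y] inner_Cauchy_Schwarz[of x "- y"]
      A_seminorm_scaleR[of "- 1" y] assms by simp
  moreover have "inner (A y) x = inner (A x) y" by (subst symmetric) (rule inner_commute)
  moreover have "inner (A y) y = 0" using assms A_seminorm_square[of y] by simp
  ultimately have "(A_seminorm A (x + y))\<^sup>2 = (A_seminorm A x)\<^sup>2"
    by (simp add: A_seminorm_square add inner_add_left inner_add_right)
  then show ?thesis by (simp add: A_seminorm_nonneg)
qed

section \<open>Boundedness of adjointable operators in the semi-norm\<close>

lemma A_symmetric_bound:
  assumes S: "bounded_linear S" and sym: "\<And>x y. inner (A (S x)) y = inner (A x) (S y)"
  shows "A_seminorm A (S x) \<le> onorm S * A_seminorm A x"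
proof -
  define g where "g k = A_seminorm A ((S ^^ k) x)" for k
  have "g 1 \<le> onorm S * g 0"
  proof (rule log_convex_geometric_bound)
    show "0 \<le> g k" for k by (simp add: g_def A_seminorm_nonneg)
    show "0 \<le> onorm S" by (rule onorm_pos_le[OF S])
    \<comment> \<open>Symmetry moves one factor \<open>S\<close> across the form, so the square is
      the form of \<open>A\<close> at \<open>S^k x\<close> and \<open>S^(k+2) x\<close>.\<close>
    show "(g (Suc k))\<^sup>2 \<le> g k * g (Suc (Suc k))" for k
      using inner_Cauchy_Schwarz[of "(S ^^ k) x" "S (S ((S ^^ k) x))"]
      by (simp add: g_def A_seminorm_square sym)
    have "norm ((S ^^ k) x) \<le> onorm S ^ k * norm x" for k
    proof (induction k)
      case (Suc k)
      have "norm ((S ^^ Suc k) x) \<le> onorm S * norm ((S ^^ k) x)"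
        using onorm[OF S] by simp
      also have "\<dots> \<le> onorm S * (onorm S ^ k * norm x)"
        by (intro mult_left_mono Suc onorm_pos_le[OF S])
      finally show ?case by simp
    qed simp
    then have "sqrt (onorm A) * norm ((S ^^ k) x) \<le> sqrt (onorm A) * (onorm S ^ k * norm x)" for k
      by (intro mult_left_mono) (auto simp: onorm_pos_le[OF linear_A])
    then show "g k \<le> sqrt (onorm A) * norm x * onorm S ^ k" for k
      using A_seminorm_le_norm[of "(S ^^ k) x"] order_trans
      by (fastforce simp: g_def mult_ac)
  qed
  then show ?thesis by (simp add: g_def)
qed

lemma A_adjointable_bound:
  assumes "T \<in> A_adjointable A"
  obtains c where "0 \<le> c" and "\<And>x. A_seminorm A (T x) \<le> c * A_seminorm A x"
proof -
  from assms obtain R where T: "T \<in> bounded_ops" and R: "R \<in> bounded_ops"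
    and AR: "A \<circ> R = cadjoint T \<circ> A"
    by (auto simp: A_adjointable_def)
  have adj: "inner (T x) (A y) = inner (A x) (R y)" for x y
  proof -
    have "inner (T x) (A y) = inner x (cadjoint T (A y))"
      using cinner_cadjoint[OF T, of x "A y"] by (simp add: inner_eq_Re_cinner)
    also have "\<dots> = inner x (A (R y))" using fun_cong[OF AR, of y] by simp
    finally show ?thesis by (simp add: symmetric)
  qed
  define S where "S = R \<circ> T"
  have S: "bounded_linear S"
    unfolding S_def comp_def
    by (rule bounded_linear_compose[OF R[THEN bounded_ops_linear] T[THEN bounded_ops_linear]])
  have "inner (A (S x)) y = inner (A x) (S y)" for x y
  proof -
    have "inner (A (S x)) y = inner (A y) (R (T x))"
      by (simp add: S_def symmetric inner_commute)
    also have "\<dots> = inner (T y) (A (T x))" by (simp add: adj)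
    also have "\<dots> = inner (T x) (A (T y))" by (subst inner_commute) (rule symmetric)
    finally show ?thesis by (simp add: adj S_def)
  qed
  note S_bound = A_symmetric_bound[OF S this]
  show thesis
  proof
    show "0 \<le> sqrt (onorm S)" by (simp add: onorm_pos_le[OF S])
    fix x
    \<comment> \<open>The adjoint relation turns the square into the form of \<open>A\<close> at
      \<open>x\<close> and \<open>R (T x)\<close>, so the constant for \<open>T\<close> is the
      square root of the one for \<open>S\<close>.\<close>
    have "(A_seminorm A (T x))\<^sup>2 = inner (A x) (S x)"
      by (simp add: A_seminorm_square inner_commute adj S_def)
    also have "\<dots> \<le> A_seminorm A x * A_seminorm A (S x)" by (rule inner_Cauchy_Schwarz)
    also have "\<dots> \<le> A_seminorm A x * (onorm S * A_seminorm A x)"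
      by (intro mult_left_mono S_bound A_seminorm_nonneg)
    also have "\<dots> = (sqrt (onorm S) * A_seminorm A x)\<^sup>2"
      by (simp add: power_mult_distrib onorm_pos_le[OF S] power2_eq_square)
    finally show "A_seminorm A (T x) \<le> sqrt (onorm S) * A_seminorm A x"
      by (rule power2_le_imp_le) (simp add: onorm_pos_le[OF S] A_seminorm_nonneg)
  qed
qed

section \<open>Numerical radius and operator norm as finite suprema\<close>

lemma bdd_above_A_numerical_radius:
  assumes "T \<in> A_adjointable A"
  shows "bdd_above (insert 0 {cmod (A_inner A (T x) x) | x. A_seminorm A x = 1})"
proof -
  obtain c where "0 \<le> c" and c: "\<And>x. A_seminorm A (T x) \<le> c * A_seminorm A x"
    using A_adjointable_bound[OF assms] by blast
  have "cmod (A_inner A (T x) x) \<le> c" if "A_seminorm A x = 1" for x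
    using A_inner_Cauchy_Schwarz[of "T x" x] c[of x] that by simp
  with \<open>0 \<le> c\<close> show ?thesis by (intro bdd_aboveI[of _ c]) auto
qed

lemma A_numerical_radius_nonneg: "T \<in> A_adjointable A \<Longrightarrow> 0 \<le> A_numerical_radius A T"
  unfolding A_numerical_radius_def
  by (rule cSup_upper[OF insertI1 bdd_above_A_numerical_radius])

text \<open>Both sides are homogeneous of degree 2, so \<open>x\<close> can be normalised. Null
  vectors cannot, but for them Cauchy--Schwarz makes the left side 0.\<close>

lemma A_inner_le_A_numerical_radius:
  assumes T: "T \<in> A_adjointable A"
  shows "cmod (A_inner A (T x) x) \<le> A_numerical_radius A T * (A_seminorm A x)\<^sup>2"
proof (cases "A_seminorm A x = 0")
  case True
  then show ?thesis using A_inner_Cauchy_Schwarz[of "T x" x] by simp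
next
  case False
  define r where "r = A_seminorm A x"
  define u where "u = complex_of_real (1 / r) *\<^sub>C x"
  have "0 < r" using False A_seminorm_nonneg[of x] by (simp add: r_def)
  have "A_seminorm A u = 1"
    using \<open>0 < r\<close> by (simp add: u_def A_seminorm_scaleC norm_divide flip: r_def)
  then have "cmod (A_inner A (T u) u) \<le> A_numerical_radius A T"
    unfolding A_numerical_radius_def
    by (intro cSup_upper[OF _ bdd_above_A_numerical_radius[OF T]]) blast
  moreover have "T \<in> bounded_ops" using T by (simp add: A_adjointable_def)
  then have "cmod (A_inner A (T u) u) = cmod (A_inner A (T x) x) / r\<^sup>2"
    using \<open>0 < r\<close> by (simp add: u_def A_inner_def bounded_ops_scaleC in_bounded_ops cinner_scaleC_left
        cinner_scaleC_right norm_mult norm_divide power2_eq_square)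
  ultimately show ?thesis using \<open>0 < r\<close> by (simp add: r_def field_simps)
qed

lemma bdd_above_A_opnorm:
  assumes "T \<in> A_adjointable A"
  shows "bdd_above (insert 0
    {A_seminorm A (T x) / A_seminorm A x | x. x \<in> closure (range A) \<and> x \<noteq> 0})"
proof -
  obtain c where "0 \<le> c" and c: "\<And>x. A_seminorm A (T x) \<le> c * A_seminorm A x"
    using A_adjointable_bound[OF assms] by blast
  \<comment> \<open>If the denominator is 0, so is the quotient by convention, and
    \<open>0 <= c\<close> suffices.\<close>
  have "A_seminorm A (T x) / A_seminorm A x \<le> c" for x
    using c[of x] \<open>0 \<le> c\<close> A_seminorm_nonneg[of x]
    by (cases "A_seminorm A x = 0") (simp_all add: field_simps)
  with \<open>0 \<le> c\<close> show ?thesis by (intro bdd_aboveI[of _ c]) auto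
qed

text \<open>The supremum defining \<open>A_opnorm\<close> only sees the closure of the range of \<open>A\<close>; its
  orthogonal complement is the kernel of \<open>A\<close>, which \<open>T\<close> maps to \<open>A\<close>-null vectors.\<close>

lemma A_seminorm_le_A_opnorm:
  assumes T: "T \<in> A_adjointable A"
  shows "A_seminorm A (T x) \<le> A_opnorm A T * A_seminorm A x"
proof -
  obtain c where c: "\<And>x. A_seminorm A (T x) \<le> c * A_seminorm A x"
    using A_adjointable_bound[OF T] by blast
  interpret T: bounded_linear T
    using T by (simp add: A_adjointable_def bounded_ops_linear)
  have "subspace (range A)" by (rule linear_subspace_image[OF linear_axioms subspace_UNIV])
  then have "subspace (closure (range A))" by (rule subspace_closure)
  then obtain a where a: "a \<in> closure (range A)"
    and orth: "\<And>m. m \<in> closure (range A) \<Longrightarrow> inner (x - a) m = 0"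
    using orthogonal_projection_exists[OF closed_closure] by metis
  define n where "n = x - a"
  \<comment> \<open>By symmetry this inner product is the squared norm of \<open>A n\<close>, so
    \<open>n\<close> lies in the kernel of \<open>A\<close>.\<close>
  have "inner n (A (A n)) = 0"
    unfolding n_def by (rule orth) (simp add: closure_subset[THEN subsetD])
  then have "A n = 0" using symmetric[of n "A n"] by simp
  then have null: "A_seminorm A n = 0"
    by (simp add: A_seminorm_def A_inner_def inner_eq_Re_cinner[symmetric])
  then have "A_seminorm A (T n) = 0" using c[of n] A_seminorm_nonneg[of "T n"] by simp
  then have Tx: "A_seminorm A (T x) = A_seminorm A (T a)"
    using A_seminorm_add_null[of "T n" "T a"] by (simp add: T.add[symmetric] n_def)
  have x: "A_seminorm A x = A_seminorm A a"
    using A_seminorm_add_null[OF null, of a] by (simp add: n_def)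
  show ?thesis
  proof (cases "A_seminorm A a = 0")
    case True
    then show ?thesis using c[of a] by (simp add: Tx x)
  next
    case False
    then have "a \<noteq> 0"
      by (auto simp: A_seminorm_def A_inner_def inner_eq_Re_cinner[symmetric] zero)
    with a have "A_seminorm A (T a) / A_seminorm A a \<le> A_opnorm A T"
      unfolding A_opnorm_def by (intro cSup_upper[OF _ bdd_above_A_opnorm[OF T]]) blast
    then show ?thesis using False A_seminorm_nonneg[of a] by (simp add: Tx x field_simps)
  qed
qed

lemma A_inner_le_A_opnorm:
  assumes "T \<in> A_adjointable A"
  shows "cmod (A_inner A (T y) x) \<le> A_opnorm A T * A_seminorm A x * A_seminorm A y"
proof -
  have "cmod (A_inner A (T y) x) \<le> A_seminorm A (T y) * A_seminorm A x"
    by (rule A_inner_Cauchy_Schwarz)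
  also have "\<dots> \<le> A_opnorm A T * A_seminorm A y * A_seminorm A x"
    by (intro mult_right_mono A_seminorm_le_A_opnorm assms A_seminorm_nonneg)
  finally show ?thesis by (simp add: mult_ac)
qed

section \<open>The block operator on the direct sum\<close>

lemma A_inner_block_diagonal:
  "A_inner (block_op A (\<lambda>_. 0) (\<lambda>_. 0) A) (x, y) (u, v) = A_inner A x u + A_inner A y v"
  by (simp add: A_inner_def block_op_def cinner_prod_def)

lemma A_inner_add_left: "A_inner A (x + y) z = A_inner A x z + A_inner A y z"
  by (simp add: A_inner_def add cinner_add_left)

end

theorem theorem4:
  fixes A T11 T12 T21 T22 :: "'a::complex_hilbert \<Rightarrow> 'a"
    and T B :: "'a \<times> 'a \<Rightarrow> 'a \<times> 'a"
  assumes nontrivial: "\<exists>x::'a. x \<noteq> 0"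
    and A: "positive_op A"
    and T11: "T11 \<in> A_adjointable A"
    and T12: "T12 \<in> A_adjointable A"
    and T21: "T21 \<in> A_adjointable A"
    and T22: "T22 \<in> A_adjointable A"
    and T: "T = block_op T11 T12 T21 T22"
    and B: "B = block_op A (\<lambda>_. 0) (\<lambda>_. 0) A"
  shows "A_numerical_radius B T \<le>
    1/2 * (A_numerical_radius A T11 + A_numerical_radius A T22
      + sqrt ((A_numerical_radius A T11)\<^sup>2 + (A_opnorm A T12)\<^sup>2)
      + sqrt ((A_numerical_radius A T22)\<^sup>2 + (A_opnorm A T21)\<^sup>2))"
    (is "_ \<le> ?rhs")
proof -
  interpret positive_operator A by unfold_locales (rule A)
  let ?w1 = "A_numerical_radius A T11" and ?w2 = "A_numerical_radius A T22"
  let ?N1 = "A_opnorm A T12" and ?N2 = "A_opnorm A T21"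
  have w: "0 \<le> ?w1" "0 \<le> ?w2" using T11 T22 by (simp_all add: A_numerical_radius_nonneg)
  have "cmod (A_inner B (T p) p) \<le> ?rhs" if "A_seminorm B p = 1" for p
  proof -
    obtain x y where p: "p = (x, y)" by (cases p)
    let ?a = "A_seminorm A x" and ?b = "A_seminorm A y"
    have "Re (A_inner A x x) + Re (A_inner A y y) = 1"
      using that by (simp add: A_seminorm_def B p A_inner_block_diagonal)
    then have ab: "?a\<^sup>2 + ?b\<^sup>2 = 1"
      by (simp add: A_seminorm_square A_inner_def inner_eq_Re_cinner)
    then have ba: "?b\<^sup>2 + ?a\<^sup>2 = 1" by simp
    have "A_inner B (T p) p = (A_inner A (T11 x) x + A_inner A (T12 y) x)
        + (A_inner A (T21 x) y + A_inner A (T22 y) y)"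
      by (simp add: T B p block_op_def[of T11] A_inner_block_diagonal A_inner_add_left)
    then have "cmod (A_inner B (T p) p) \<le> cmod (A_inner A (T11 x) x) + cmod (A_inner A (T12 y) x)
        + (cmod (A_inner A (T21 x) y) + cmod (A_inner A (T22 y) y))"
      by (metis add_mono norm_triangle_ineq norm_triangle_mono)
    \<comment> \<open>The second row is written with \<open>?b\<close> before \<open>?a\<close>: the
      eigenvalue bound applies to it with the roles of the two semi-norms exchanged.\<close>
    also have "\<dots> \<le> ?w1 * ?a\<^sup>2 + ?N1 * ?a * ?b + (?N2 * ?b * ?a + ?w2 * ?b\<^sup>2)"
      by (intro add_mono A_inner_le_A_numerical_radius A_inner_le_A_opnorm T11 T12 T21 T22)
    also have "\<dots> \<le> ?rhs"
      using quadratic_form_le_eigenvalue[OF w(1), of ?a ?N1 ?b]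
        quadratic_form_le_eigenvalue[OF w(2), of ?b ?N2 ?a] unfolding ab ba by argo
    finally show ?thesis .
  qed
  \<comment> \<open>Covers the 0 adjoined to the set in the definition of the supremum.\<close>
  moreover have "0 \<le> ?rhs" using w by simp
  ultimately show ?thesis
    unfolding A_numerical_radius_def[of B] by (intro cSup_least) auto
qed

end
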